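(* For each $i\in\{1,2\}$, let $X_i$ be a Banach space and let $V_i$ be a non-empty closed convex subset of $X_i$ such that $(V_i,\mathcal{CB}(X_i))$ has the restricted center property. Let $X=X_1\oplus_\infty X_2$ and $V=V_1\times V_2$. If for each $i\in\{1,2\}$ the map $\mathrm{cent}_{V_i}(\cdot)$ is lower Hausdorff semi-continuous on $\mathcal{CB}(X_i)$, then the map $\mathrm{cent}_V(\cdot)$ is lower Hausdorff semi-continuous on $\mathcal{CB}(X)$.
   Context: All Banach spaces are real. $X_1\oplus_\infty X_2$ is $X_1\times X_2$ with the norm $\|(x_1,x_2)\|=\max\{\|x_1\|,\|x_2\|\}$. For a Banach space $E$, $B_E$ is its closed unit ball, $B_E(z,\varepsilon)$ the open ball of center $z$ and radius $\varepsilon$, and $\mathcal{CB}(E)$ the class of non-empty closed bounded subsets of $E$, equipped with the Hausdorff metric $d_H(A,B)=\inf\{t>0: A\subseteq B+tB_E,\ B\subseteq A+tB_E\}$. For $v\in E$ and a non-empty bounded set $F\subseteq E$, $r(v,F)=\sup_{z\in F}\|v-z\|$. For a non-empty closed convex $V\subseteq E$: $\mathrm{rad}_V(F)=\inf_{v\in V}r(v,F)$ and $\mathrm{cent}_V(F)=\{v\in V: r(v,F)=\mathrm{rad}_V(F)\}$. The pair $(V,\mathcal{CB}(E))$ has the restricted center property if $\mathrm{cent}_V(F)\ne\emptyset$ for every $F\in\mathcal{CB}(E)$. A set-valued map $\Phi:\mathcal{CB}(E)\to\mathcal{CB}(E)$ is lower Hausdorff semi-continuous on $\mathcal{CB}(E)$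 if for each $B\in\mathcal{CB}(E)$ and $\varepsilon>0$ there is $\delta>0$ such that for every $A\in\mathcal{CB}(E)$ with $d_H(A,B)<\delta$ and every $z\in\Phi(B)$, $B_E(z,\varepsilon)\cap\Phi(A)\neq\emptyset$. *)

theory Defs
  imports "HOL-Analysis.Analysis"
begin

section \<open>The \<open>\<ell>\<^sub>\<infinity>\<close>-sum of two Banach spaces\<close>

text \<open>The library norm on \<^typ>\<open>'a \<times> 'b\<close> is the Euclidean one, so the sum with the
  maximum norm needs a type of its own.\<close>

datatype ('a, 'b) linf_sum = Linf (lfst: 'a) (lsnd: 'b)

lemma linf_sum_eq_iff: "x = y \<longleftrightarrow> lfst x = lfst y \<and> lsnd x = lsnd y"
  by (cases x; cases y) auto

instantiation linf_sum :: (real_normed_vector, real_normed_vector) real_normed_vector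
begin

definition zero_linf_sum :: "('a, 'b) linf_sum" where
  "0 = Linf 0 0"
definition plus_linf_sum :: "('a, 'b) linf_sum \<Rightarrow> ('a, 'b) linf_sum \<Rightarrow> ('a, 'b) linf_sum" where
  "x + y = Linf (lfst x + lfst y) (lsnd x + lsnd y)"
definition minus_linf_sum :: "('a, 'b) linf_sum \<Rightarrow> ('a, 'b) linf_sum \<Rightarrow> ('a, 'b) linf_sum" where
  "x - y = Linf (lfst x - lfst y) (lsnd x - lsnd y)"
definition uminus_linf_sum :: "('a, 'b) linf_sum \<Rightarrow> ('a, 'b) linf_sum" where
  "- x = Linf (- lfst x) (- lsnd x)"
definition scaleR_linf_sum :: "real \<Rightarrow> ('a, 'b) linf_sum \<Rightarrow> ('a, 'b) linf_sum" where
  "c *\<^sub>R x = Linf (c *\<^sub>R lfst x) (c *\<^sub>R lsnd x)"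
definition norm_linf_sum :: "('a, 'b) linf_sum \<Rightarrow> real" where
  "norm_linf_sum x = max (norm (lfst x)) (norm (lsnd x))"
definition sgn_linf_sum :: "('a, 'b) linf_sum \<Rightarrow> ('a, 'b) linf_sum" where
  "sgn_linf_sum x = inverse (norm x) *\<^sub>R x"
definition dist_linf_sum :: "('a, 'b) linf_sum \<Rightarrow> ('a, 'b) linf_sum \<Rightarrow> real" where
  "dist_linf_sum x y = norm (x - y)"
definition uniformity_linf_sum :: "(('a, 'b) linf_sum \<times> ('a, 'b) linf_sum) filter" where
  "uniformity_linf_sum = (INF e\<in>{0<..}. principal {(x, y). dist x y < e})"
definition open_linf_sum :: "('a, 'b) linf_sum set \<Rightarrow> bool" where
  "open_linf_sum U \<longleftrightarrow> (\<forall>x\<in>U. eventually (\<lambda>(x', y). x' = x \<longrightarrow> y \<in> U) uniformity)"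

instance
proof
  fix x y :: "('a, 'b) linf_sum" and c :: real
  have tri1: "norm (lfst x + lfst y) \<le> norm (lfst x) + norm (lfst y)"
    and tri2: "norm (lsnd x + lsnd y) \<le> norm (lsnd x) + norm (lsnd y)"
    by (rule norm_triangle_ineq)+
  show "norm (x + y) \<le> norm x + norm y"
    unfolding norm_linf_sum_def plus_linf_sum_def linf_sum.sel
    using tri1 tri2 by linarith
  have "max (\<bar>c\<bar> * a) (\<bar>c\<bar> * b) = \<bar>c\<bar> * max a b" for a b :: real
    by (simp add: max_mult_distrib_left)
  then show "norm (c *\<^sub>R x) = \<bar>c\<bar> * norm x"
    by (simp add: norm_linf_sum_def scaleR_linf_sum_def)
  show "norm x = 0 \<longleftrightarrow> x = 0"
  proof
    assume "norm x = 0"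
    then have "norm (lfst x) \<le> 0" "norm (lsnd x) \<le> 0"
      by (simp_all add: norm_linf_sum_def max_def split: if_splits)
    then show "x = 0" by (simp add: linf_sum_eq_iff zero_linf_sum_def)
  qed (simp add: norm_linf_sum_def zero_linf_sum_def)
qed (simp_all add: linf_sum_eq_iff zero_linf_sum_def plus_linf_sum_def minus_linf_sum_def
      uminus_linf_sum_def scaleR_linf_sum_def sgn_linf_sum_def dist_linf_sum_def
      uniformity_linf_sum_def open_linf_sum_def algebra_simps)

end

instance linf_sum :: (banach, banach) banach
proof
  fix X :: "nat \<Rightarrow> ('a, 'b) linf_sum"
  assume X: "Cauchy X"
  have d: "dist x y = max (dist (lfst x) (lfst y)) (dist (lsnd x) (lsnd y))"
    for x y :: "('a, 'b) linf_sum"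
    by (simp add: dist_norm norm_linf_sum_def minus_linf_sum_def)
  have "Cauchy (\<lambda>n. lfst (X n))" "Cauchy (\<lambda>n. lsnd (X n))"
    using X unfolding Cauchy_def d by (meson max_less_iff_conj)+
  then obtain a b where "(\<lambda>n. lfst (X n)) \<longlonglongrightarrow> a" "(\<lambda>n. lsnd (X n)) \<longlonglongrightarrow> b"
    by (auto simp: Cauchy_convergent_iff convergent_def)
  then have "X \<longlonglongrightarrow> Linf a b"
    unfolding tendsto_iff d by (auto intro: eventually_conj)
  then show "convergent X" by (auto simp: convergent_def)
qed

definition linf_Times :: "'a set \<Rightarrow> 'b set \<Rightarrow> ('a, 'b) linf_sum set" where
  "linf_Times A B = {Linf a b | a b. a \<in> A \<and> b \<in> B}"

section \<open>Closed bounded sets and restricted Chebyshev centers\<close>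

definition CB :: "'a::real_normed_vector set set" where
  "CB = {F. F \<noteq> {} \<and> closed F \<and> bounded F}"

definition hausdorff_dist :: "'a::real_normed_vector set \<Rightarrow> 'a set \<Rightarrow> real" where
  "hausdorff_dist A B = Inf {t. t > 0 \<and>
     A \<subseteq> {b + t *\<^sub>R u | b u. b \<in> B \<and> u \<in> cball 0 1} \<and>
     B \<subseteq> {a + t *\<^sub>R u | a u. a \<in> A \<and> u \<in> cball 0 1}}"

definition radius_at :: "'a::real_normed_vector \<Rightarrow> 'a set \<Rightarrow> real" where
  "radius_at v F = (SUP z\<in>F. norm (v - z))"

definition rad :: "'a::real_normed_vector set \<Rightarrow> 'a set \<Rightarrow> real" where
  "rad V F = (INF v\<in>V. radius_at v F)"

definition cent :: "'a::real_normed_vector set \<Rightarrow> 'a set \<Rightarrow> 'a set" where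
  "cent V F = {v \<in> V. radius_at v F = rad V F}"

text \<open>The property of the pair formed by \<open>V\<close> and the class of all closed bounded sets.\<close>

definition restricted_center_property :: "'a::real_normed_vector set \<Rightarrow> bool" where
  "restricted_center_property V \<longleftrightarrow> (\<forall>F\<in>CB. cent V F \<noteq> {})"

text \<open>The first conjunct says that \<open>\<Phi>\<close> is a map from \<^const>\<open>CB\<close> to \<^const>\<open>CB\<close>; its
  values outside \<^const>\<open>CB\<close> are irrelevant.  The number \<open>\<delta>\<close> must not depend on \<open>z\<close>.\<close>

definition lower_Hausdorff_semicontinuous ::
    "('a::real_normed_vector set \<Rightarrow> 'a set) \<Rightarrow> bool" where
  "lower_Hausdorff_semicontinuous \<Phi> \<longleftrightarrow>
     (\<forall>F\<in>CB. \<Phi> F \<in> CB) \<and>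
     (\<forall>B\<in>CB. \<forall>\<epsilon>>0. \<exists>\<delta>>0. \<forall>A\<in>CB. hausdorff_dist A B < \<delta> \<longrightarrow>
        (\<forall>z\<in>\<Phi> B. ball z \<epsilon> \<inter> \<Phi> A \<noteq> {}))"

end

theory Submission
  imports Defs
begin

text \<open>Let \<open>F\<^sub>i\<close> be the closure of the \<open>i\<close>-th projection of \<open>F\<close>, and let \<open>R\<close> be the larger
  of the restricted radii of \<open>F\<^sub>1\<close> in \<open>V\<^sub>1\<close> and of \<open>F\<^sub>2\<close> in \<open>V\<^sub>2\<close>. Then \<open>cent\<^sub>V(F)\<close> is the product of the sets
  \<open>{v \<in> V\<^sub>i. r(v, F\<^sub>i) \<le> R}\<close>, so it suffices to perturb these sublevel sets one coordinate at a
  time. If \<open>R\<close> equals the \<open>i\<close>-th restricted radius, the sublevel set is the center set and the hypothesis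
  applies. If \<open>R\<close> is strictly larger, moving a point slightly towards a fixed center of \<open>F\<^sub>i\<close>
  decreases \<open>r(\<cdot>, F\<^sub>i)\<close> by a definite amount, which absorbs the effect of a small change of \<open>F\<close>.\<close>

section \<open>Radii and the Hausdorff distance\<close>

lemma radius_at_le_iff:
  assumes "F \<noteq> {}" "bounded F"
  shows "radius_at v F \<le> r \<longleftrightarrow> (\<forall>z\<in>F. norm (v - z) \<le> r)"
proof -
  obtain e where "\<forall>z\<in>F. dist v z \<le> e"
    using assms(2) bounded_any_center by blast
  then have "bdd_above ((\<lambda>z. norm (v - z)) ` F)"
    by (auto simp: dist_norm bdd_above_def)
  then show ?thesis
    unfolding radius_at_def using cSUP_le_iff[OF assms(1)] by blast
qed

lemma norm_le_radius_at:
  assumes "F \<in> CB" "z \<in> F"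
  shows "norm (v - z) \<le> radius_at v F"
  using radius_at_le_iff[of F v "radius_at v F"] assms by (auto simp: CB_def)

lemma radius_at_nonneg:
  assumes "F \<in> CB"
  shows "0 \<le> radius_at v F"
proof -
  obtain z where "z \<in> F" using assms by (auto simp: CB_def)
  then show ?thesis
    using norm_le_radius_at[OF assms] order_trans[OF norm_ge_zero] by blast
qed

lemma rad_le_radius_at:
  assumes "F \<in> CB" "v \<in> V"
  shows "rad V F \<le> radius_at v F"
  unfolding rad_def using assms radius_at_nonneg
  by (intro cINF_lower bdd_belowI2[where m = 0]) auto

lemma closed_sublevel_radius_at:
  assumes "F \<in> CB" "closed V"
  shows "closed {v \<in> V. radius_at v F \<le> r}"
proof -
  have "{v \<in> V. radius_at v F \<le> r} = V \<inter> (\<Inter>z\<in>F. cball z r)"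
    using assms radius_at_le_iff[of F] by (auto simp: CB_def dist_norm norm_minus_commute)
  then show ?thesis using assms(2) by auto
qed

lemma bounded_sublevel_radius_at:
  assumes "F \<in> CB"
  shows "bounded {v \<in> V. radius_at v F \<le> r}"
proof -
  obtain z where z: "z \<in> F" using assms by (auto simp: CB_def)
  have "{v \<in> V. radius_at v F \<le> r} \<subseteq> cball z r"
    using order_trans[OF norm_le_radius_at[OF assms z]]
    by (auto simp: dist_norm norm_minus_commute)
  then show ?thesis using bounded_cball bounded_subset by blast
qed

section \<open>Approximation form of the Hausdorff distance\<close>

lemma subset_add_cball_iff:
  fixes A B :: "'a::real_normed_vector set"
  assumes "t > 0"
  shows "A \<subseteq> {b + t *\<^sub>R u | b u. b \<in> B \<and> u \<in> cball 0 1}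
    \<longleftrightarrow> (\<forall>a\<in>A. \<exists>b\<in>B. norm (a - b) \<le> t)"
proof -
  have "(\<exists>u. a = b + t *\<^sub>R u \<and> u \<in> cball 0 1) \<longleftrightarrow> norm (a - b) \<le> t" for a b :: 'a
  proof
    assume "norm (a - b) \<le> t"
    then have "a = b + t *\<^sub>R ((1 / t) *\<^sub>R (a - b)) \<and> (1 / t) *\<^sub>R (a - b) \<in> cball 0 1"
      using assms by (simp add: divide_simps)
    then show "\<exists>u. a = b + t *\<^sub>R u \<and> u \<in> cball 0 1" by blast
  qed (use assms in \<open>auto simp: mult_left_le\<close>)
  then show ?thesis by blast
qed

text \<open>Boundedness makes the set of admissible \<open>t\<close> non-empty and 0 bounds it
  below, so its infimum lies below \<open>d\<close> exactly when some admissible \<open>t\<close>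
  does.\<close>

lemma hausdorff_dist_less_iff:
  fixes A B :: "'a::real_normed_vector set"
  assumes "A \<in> CB" "B \<in> CB"
  shows "hausdorff_dist A B < d \<longleftrightarrow> (\<exists>t>0. t < d \<and>
    (\<forall>a\<in>A. \<exists>b\<in>B. norm (a - b) \<le> t) \<and> (\<forall>b\<in>B. \<exists>a\<in>A. norm (a - b) \<le> t))"
proof -
  let ?T = "{t. t > 0 \<and> (\<forall>a\<in>A. \<exists>b\<in>B. norm (a - b) \<le> t) \<and> (\<forall>b\<in>B. \<exists>a\<in>A. norm (a - b) \<le> t)}"
  have eq: "hausdorff_dist A B = Inf ?T"
    unfolding hausdorff_dist_def
    by (rule arg_cong[where f = Inf])
      (auto simp only: mem_Collect_eq subset_add_cball_iff norm_minus_commute cong: conj_cong)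
  obtain e where e: "\<forall>a\<in>A. \<forall>b\<in>B. norm (a - b) \<le> e"
  proof -
    have "bounded ((\<lambda>(a, b). a - b) ` (A \<times> B))"
      using assms by (intro bounded_minus) (auto simp: CB_def)
    then show ?thesis using that by (auto simp: bounded_iff)
  qed
  \<comment> \<open>The 1 ensures positivity: \<open>e\<close> may be 0.\<close>
  have "max e 1 \<in> ?T"
    using assms e by (fastforce simp: CB_def)
  then have "?T \<noteq> {}" by blast
  moreover have "bdd_below ?T" by (auto intro: bdd_belowI[where m = 0])
  ultimately show ?thesis
    unfolding eq by (subst cInf_less_iff) auto
qed

text \<open>Triangle inequality through a point of the other set within some \<open>t < d\<close>;
  the gap between \<open>t\<close> and \<open>d\<close> gives strictness.\<close>

lemma radius_at_perturb:
  assumes "A \<in> CB" "B \<in> CB" "hausdorff_dist A B < d"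
  shows "radius_at v A < radius_at v B + d" "radius_at v B < radius_at v A + d"
proof -
  obtain t where t: "t < d" "\<forall>a\<in>A. \<exists>b\<in>B. norm (a - b) \<le> t" "\<forall>b\<in>B. \<exists>a\<in>A. norm (a - b) \<le> t"
    using assms hausdorff_dist_less_iff by blast
  have "radius_at v A \<le> radius_at v B + t"
  proof (subst radius_at_le_iff; (use assms in \<open>force simp: CB_def\<close>)?)
    show "\<forall>a\<in>A. norm (v - a) \<le> radius_at v B + t"
    proof
      fix a assume "a \<in> A"
      then obtain b where b: "b \<in> B" "norm (a - b) \<le> t" using t by blast
      then show "norm (v - a) \<le> radius_at v B + t"
        using norm_le_radius_at[OF assms(2) b(1), of v] norm_triangle_ineq4[of "v - b" "a - b"]
        by simp
    qed
  qed
  then show "radius_at v A < radius_at v B + d" using t by simp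
  have "radius_at v B \<le> radius_at v A + t"
  proof (subst radius_at_le_iff; (use assms in \<open>force simp: CB_def\<close>)?)
    show "\<forall>b\<in>B. norm (v - b) \<le> radius_at v A + t"
    proof
      fix b assume "b \<in> B"
      then obtain a where a: "a \<in> A" "norm (a - b) \<le> t" using t by blast
      then show "norm (v - b) \<le> radius_at v A + t"
        using norm_le_radius_at[OF assms(1) a(1), of v] norm_triangle_ineq[of "v - a" "a - b"]
        by simp
    qed
  qed
  then show "radius_at v B < radius_at v A + d" using t by simp
qed

section \<open>Stability of restricted radii and of sublevel sets of the radius\<close>

lemma restricted_center_propertyE:
  assumes "restricted_center_property V" "F \<in> CB"
  obtains c where "c \<in> V" "radius_at c F = rad V F"
  using assms unfolding restricted_center_property_def cent_def by blast

text \<open>A center of \<open>A\<close> competes for \<open>B\<close> with radius below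
  \<open>rad V A + d\<close>. Since the infimum for \<open>A\<close> is attained, strictness
  survives.\<close>

lemma rad_less_rad_add:
  assumes "restricted_center_property V" "A \<in> CB" "B \<in> CB" "hausdorff_dist A B < d"
  shows "rad V B < rad V A + d"
  using assms by (metis rad_le_radius_at radius_at_perturb(2) order_le_less_trans
    restricted_center_propertyE)

text \<open>The levels \<open>R\<close> and \<open>R'\<close> are decoupled from the restricted
  radii because in the sum the other coordinate may determine them. A one-sided bound on
  \<open>R'\<close> suffices, since raising \<open>R'\<close> only enlarges the target sublevel set.
  As the semi-continuity demands, \<delta> is uniform in \<open>z\<close>.\<close>

lemma sublevel_radius_at_perturb:
  fixes V :: "'a::real_normed_vector set"
  assumes "convex V" and rcp: "restricted_center_property V"
    and lsc: "lower_Hausdorff_semicontinuous (cent V)"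
    and B: "B \<in> CB" and R: "rad V B \<le> R" and "\<epsilon> > 0"
  obtains \<delta> where "\<delta> > 0"
    "\<And>A R' z. A \<in> CB \<Longrightarrow> hausdorff_dist A B < \<delta> \<Longrightarrow> rad V A \<le> R' \<Longrightarrow> R < R' + \<delta> \<Longrightarrow>
       z \<in> V \<Longrightarrow> radius_at z B \<le> R \<Longrightarrow> \<exists>w\<in>V. radius_at w A \<le> R' \<and> dist z w < \<epsilon>"
proof (cases "R = rad V B")
  case True
  obtain \<delta> where \<delta>: "\<delta> > 0" and
    *: "\<forall>A\<in>CB. hausdorff_dist A B < \<delta> \<longrightarrow> (\<forall>z\<in>cent V B. ball z \<epsilon> \<inter> cent V A \<noteq> {})"
    using lsc B \<open>\<epsilon> > 0\<close> unfolding lower_Hausdorff_semicontinuous_def by blast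
  show thesis
  proof (rule that[OF \<delta>])
    fix A R' z
    assume A: "A \<in> CB" "hausdorff_dist A B < \<delta>" "rad V A \<le> R'"
      and z: "z \<in> V" "radius_at z B \<le> R"
    have "z \<in> cent V B"
      using z rad_le_radius_at[OF B] True by (auto simp: cent_def intro: antisym)
    then obtain w where "w \<in> ball z \<epsilon>" "w \<in> cent V A" using * A by blast
    then show "\<exists>w\<in>V. radius_at w A \<le> R' \<and> dist z w < \<epsilon>"
      using A by (intro bexI[of _ w]) (auto simp: cent_def)
  qed
next
  case False
  define g where "g = R - rad V B"
  have g: "g > 0" using False R by (simp add: g_def)
  obtain c where c: "c \<in> V" "radius_at c B = rad V B"
    using rcp B restricted_center_propertyE by blast
  obtain b where b: "b \<in> B" using B by (auto simp: CB_def)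
  \<comment> \<open>Through the point \<open>b\<close>, every \<open>z\<close> in the sublevel set
    satisfies \<open>norm (z - c) \<le> R + rad V B\<close>; the added 1 makes the bound strict and
    positive.\<close>
  define M where "M = R + rad V B + 1"
  have M: "M > 0" using radius_at_nonneg[OF B, of c] c R by (simp add: M_def)
  \<comment> \<open>The fraction of the way from \<open>z\<close> to \<open>c\<close>: at most 1 to
    stay in \<open>V\<close> by convexity, and small enough that the move is shorter than
    \<epsilon>.\<close>
  define t where "t = min 1 (\<epsilon> / M)"
  have t: "0 < t" "t \<le> 1" "t * M \<le> \<epsilon>"
    using M \<open>\<epsilon> > 0\<close> by (auto simp: t_def min_def field_simps)
  \<comment> \<open>Moving towards \<open>c\<close> lowers the radius bound by \<open>t * g\<close>.
    One half pays for replacing \<open>B\<close> by \<open>A\<close>, the other for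
    \<open>R'\<close> lying below \<open>R\<close>.\<close>
  have \<delta>: "t * g / 2 > 0" using t g by simp
  show thesis
  proof (rule that[OF \<delta>])
    fix A R' z
    assume A: "A \<in> CB" "hausdorff_dist A B < t * g / 2"
      and R': "R < R' + t * g / 2" and z: "z \<in> V" "radius_at z B \<le> R"
    define w where "w = (1 - t) *\<^sub>R z + t *\<^sub>R c"
    have "w \<in> V"
      using \<open>convex V\<close> z c t unfolding w_def by (intro convexD_alt) auto
    moreover have "radius_at w A \<le> R'"
    proof (subst radius_at_le_iff; (use A in \<open>force simp: CB_def\<close>)?)
      show "\<forall>a\<in>A. norm (w - a) \<le> R'"
      proof
        fix a assume a: "a \<in> A"
        have za: "norm (z - a) \<le> R + t * g / 2"
          using norm_le_radius_at[OF A(1) a, of z] radius_at_perturb(1)[OF A(1) B A(2), of z] z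
          by simp
        have ca: "norm (c - a) \<le> R - g + t * g / 2"
          using norm_le_radius_at[OF A(1) a, of c] radius_at_perturb(1)[OF A(1) B A(2), of c] c
          by (simp add: g_def)
        have "w - a = (1 - t) *\<^sub>R (z - a) + t *\<^sub>R (c - a)"
          by (simp add: w_def algebra_simps)
        then have "norm (w - a) \<le> (1 - t) * norm (z - a) + t * norm (c - a)"
          using norm_triangle_ineq[of "(1 - t) *\<^sub>R (z - a)" "t *\<^sub>R (c - a)"] t by simp
        also have "\<dots> \<le> (1 - t) * (R + t * g / 2) + t * (R - g + t * g / 2)"
          using t za ca by (intro add_mono mult_left_mono) auto
        also have "\<dots> = R - t * g / 2" by (simp add: field_simps)
        finally show "norm (w - a) \<le> R'" using R' by simp
      qed
    qed
    moreover have "dist z w < \<epsilon>"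
    proof -
      have "norm (z - c) \<le> norm (z - b) + norm (c - b)"
        using norm_triangle_ineq4[of "z - b" "c - b"] by simp
      also have "\<dots> < M"
        using norm_le_radius_at[OF B b, of z] norm_le_radius_at[OF B b, of c] z c
        by (simp add: M_def)
      finally have "t * norm (z - c) < t * M" using t by simp
      then have "t * norm (z - c) < \<epsilon>" using t by linarith
      moreover have "z - w = t *\<^sub>R (z - c)" by (simp add: w_def algebra_simps)
      ultimately show ?thesis using t by (simp add: dist_norm)
    qed
    ultimately show "\<exists>w\<in>V. radius_at w A \<le> R' \<and> dist z w < \<epsilon>" by blast
  qed
qed

section \<open>Projections of the \<open>\<ell>\<^sub>\<infinity>\<close>-sum\<close>

lemma bounded_linear_lfst: "bounded_linear lfst"
  by (rule bounded_linear_intro[where K = 1])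
    (auto simp: plus_linf_sum_def scaleR_linf_sum_def norm_linf_sum_def)

lemma bounded_linear_lsnd: "bounded_linear lsnd"
  by (rule bounded_linear_intro[where K = 1])
    (auto simp: plus_linf_sum_def scaleR_linf_sum_def norm_linf_sum_def)

lemma norm_diff_linf_sum:
  "norm (x - y) = max (norm (lfst x - lfst y)) (norm (lsnd x - lsnd y))"
  by (simp add: norm_linf_sum_def minus_linf_sum_def)

lemma linf_Times_eq_vimage: "linf_Times A B = lfst -` A \<inter> lsnd -` B"
  by (force simp: linf_Times_def linf_sum_eq_iff)

lemma closed_linf_Times:
  assumes "closed A" "closed B"
  shows "closed (linf_Times A B)"
  unfolding linf_Times_eq_vimage using assms
  by (intro closed_Int closed_vimage linear_continuous_on bounded_linear_lfst bounded_linear_lsnd)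

lemma bounded_linf_Times:
  assumes "bounded A" "bounded B"
  shows "bounded (linf_Times A B)"
proof -
  obtain a b where "\<forall>x\<in>A. norm x \<le> a" "\<forall>x\<in>B. norm x \<le> b"
    using assms by (auto simp: bounded_iff)
  then have "\<forall>x\<in>linf_Times A B. norm x \<le> max a b"
    by (force simp: linf_Times_def norm_linf_sum_def)
  then show ?thesis by (auto simp: bounded_iff)
qed

text \<open>The closure is taken because a projection of a closed bounded set need not be
  closed.\<close>

lemma closure_image_in_CB:
  assumes "bounded_linear f" "F \<in> CB"
  shows "closure (f ` F) \<in> CB"
  using assms by (auto simp: CB_def intro: bounded_linear_image)

lemma hausdorff_dist_closure_image:
  assumes f: "bounded_linear f" and nonexp: "\<And>x y. norm (f x - f y) \<le> norm (x - y)"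
    and A: "A \<in> CB" and B: "B \<in> CB" and "hausdorff_dist A B < d"
  shows "hausdorff_dist (closure (f ` A)) (closure (f ` B)) < d"
proof -
  obtain t where t: "0 < t" "t < d" "\<forall>a\<in>A. \<exists>b\<in>B. norm (a - b) \<le> t"
    "\<forall>b\<in>B. \<exists>a\<in>A. norm (a - b) \<le> t"
    using assms hausdorff_dist_less_iff by blast
  \<comment> \<open>A point of the closure is only approximated by image points; the slack
    \<open>s - t\<close> covers that error while \<open>s\<close> stays below
    \<open>d\<close>.\<close>
  define s where "s = (t + d) / 2"
  have s: "0 < s" "t < s" "s < d" using t by (auto simp: s_def)
  have near: "\<exists>y\<in>closure (f ` D). norm (x - y) \<le> s"
    if CD: "\<forall>a\<in>C. \<exists>b\<in>D. norm (a - b) \<le> t" and x: "x \<in> closure (f ` C)" for C D x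
  proof -
    have "0 < s - t" using s by simp
    with x obtain a where a: "a \<in> C" "dist (f a) x < s - t"
      unfolding closure_approachable by blast
    then obtain b where b: "b \<in> D" "norm (a - b) \<le> t" using CD by blast
    have "norm (x - f b) \<le> norm (x - f a) + norm (f a - f b)"
      using norm_triangle_ineq[of "x - f a" "f a - f b"] by simp
    also have "\<dots> \<le> s"
      using a(2) b(2) nonexp[of a b] by (simp add: dist_norm norm_minus_commute)
    finally show ?thesis using b(1) closure_subset by blast
  qed
  have "\<forall>x\<in>closure (f ` A). \<exists>y\<in>closure (f ` B). norm (x - y) \<le> s"
    using near t by blast
  moreover have "\<forall>y\<in>closure (f ` B). \<exists>x\<in>closure (f ` A). norm (x - y) \<le> s"
    using near[of B A] t by (metis norm_minus_commute)
  ultimately show ?thesis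
    using hausdorff_dist_less_iff[OF closure_image_in_CB[OF f A] closure_image_in_CB[OF f B]] s
    by blast
qed

section \<open>Radii and centers in the sum, computed by coordinates\<close>

lemma radius_at_closure_le_iff:
  assumes "F \<noteq> {}" "bounded F"
  shows "radius_at v (closure F) \<le> r \<longleftrightarrow> (\<forall>z\<in>F. norm (v - z) \<le> r)"
proof -
  have "F \<subseteq> cball v r \<longleftrightarrow> closure F \<subseteq> cball v r"
    using closure_minimal[of F "cball v r"] closure_subset[of F] by auto
  then show ?thesis
    using assms by (subst radius_at_le_iff) (auto simp: dist_norm subset_iff)
qed

lemma radius_at_linf_sum:
  assumes "F \<in> CB"
  shows "radius_at x F =
    max (radius_at (lfst x) (closure (lfst ` F))) (radius_at (lsnd x) (closure (lsnd ` F)))"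
proof -
  have F: "F \<noteq> {}" "bounded F" "bounded (lfst ` F)" "bounded (lsnd ` F)"
    using assms bounded_linear_lfst bounded_linear_lsnd
    by (auto simp: CB_def intro: bounded_linear_image)
  \<comment> \<open>Two reals with the same upper bounds are equal, and a bound on the maximum norm
    splits into one bound per coordinate.\<close>
  have "radius_at x F \<le> r \<longleftrightarrow>
      max (radius_at (lfst x) (closure (lfst ` F))) (radius_at (lsnd x) (closure (lsnd ` F))) \<le> r"
    for r
    using F by (auto simp: radius_at_le_iff radius_at_closure_le_iff norm_diff_linf_sum)
  then show ?thesis by (meson order_antisym order_refl)
qed

text \<open>Pairing a center from each coordinate attains the value, and no point of the product can
  beat either restricted radius.\<close>

lemma rad_linf_Times:
  assumes "restricted_center_property V1" "restricted_center_property V2" and F: "F \<in> CB"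
  shows "rad (linf_Times V1 V2) F =
    max (rad V1 (closure (lfst ` F))) (rad V2 (closure (lsnd ` F)))"
proof -
  note CB1 = closure_image_in_CB[OF bounded_linear_lfst F]
    and CB2 = closure_image_in_CB[OF bounded_linear_lsnd F]
  obtain c1 where c1: "c1 \<in> V1" "radius_at c1 (closure (lfst ` F)) = rad V1 (closure (lfst ` F))"
    using restricted_center_propertyE[OF assms(1) CB1] by blast
  obtain c2 where c2: "c2 \<in> V2" "radius_at c2 (closure (lsnd ` F)) = rad V2 (closure (lsnd ` F))"
    using restricted_center_propertyE[OF assms(2) CB2] by blast
  show ?thesis
    unfolding rad_def[of "linf_Times V1 V2"]
  proof (rule cInf_eq_minimum)
    have "Linf c1 c2 \<in> linf_Times V1 V2"
      using c1 c2 by (simp add: linf_Times_eq_vimage)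
    then show "max (rad V1 (closure (lfst ` F))) (rad V2 (closure (lsnd ` F)))
        \<in> (\<lambda>v. radius_at v F) ` linf_Times V1 V2"
      by (rule rev_image_eqI) (simp add: radius_at_linf_sum[OF F] c1 c2)
  next
    fix r assume "r \<in> (\<lambda>v. radius_at v F) ` linf_Times V1 V2"
    then show "max (rad V1 (closure (lfst ` F))) (rad V2 (closure (lsnd ` F))) \<le> r"
      using rad_le_radius_at[OF CB1] rad_le_radius_at[OF CB2]
      by (auto simp: radius_at_linf_sum[OF F] linf_Times_eq_vimage intro: max.mono
        simp del: max.bounded_iff)
  qed
qed

text \<open>Being a center means having radius at most \<open>R\<close>, a condition on each
  coordinate separately. The coordinate with the smaller restricted radius has room to spare, hence
  sublevel sets and not center sets.\<close>

lemma cent_linf_Times: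
  assumes "restricted_center_property V1" "restricted_center_property V2" and F: "F \<in> CB"
    and R: "R = max (rad V1 (closure (lfst ` F))) (rad V2 (closure (lsnd ` F)))"
  shows "cent (linf_Times V1 V2) F =
    linf_Times {v \<in> V1. radius_at v (closure (lfst ` F)) \<le> R}
      {v \<in> V2. radius_at v (closure (lsnd ` F)) \<le> R}"
proof -
  have "x \<in> cent (linf_Times V1 V2) F \<longleftrightarrow> x \<in> linf_Times V1 V2 \<and> radius_at x F \<le> R" for x
    using rad_le_radius_at[OF F, of x "linf_Times V1 V2"]
    by (auto simp: cent_def rad_linf_Times[OF assms(1-3)] R)
  then show ?thesis
    by (auto simp: linf_Times_eq_vimage radius_at_linf_sum[OF F])
qed

section \<open>Lower semi-continuity of the center map of the sum\<close>

theorem proposition4p1: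
  fixes V1 :: "'a::banach set" and V2 :: "'b::banach set"
  assumes "V1 \<noteq> {}" and "closed V1" and "convex V1"
    and "V2 \<noteq> {}" and "closed V2" and "convex V2"
    and "restricted_center_property V1"
    and "restricted_center_property V2"
    and "lower_Hausdorff_semicontinuous (cent V1)"
    and "lower_Hausdorff_semicontinuous (cent V2)"
  shows "lower_Hausdorff_semicontinuous (cent (linf_Times V1 V2))"
proof -
  let ?p = "\<lambda>F :: ('a, 'b) linf_sum set. closure (lfst ` F)"
  let ?q = "\<lambda>F :: ('a, 'b) linf_sum set. closure (lsnd ` F)"
  define R where "R F = max (rad V1 (?p F)) (rad V2 (?q F))" for F
  note CB1 = closure_image_in_CB[OF bounded_linear_lfst]
    and CB2 = closure_image_in_CB[OF bounded_linear_lsnd]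
  note cent_eq = cent_linf_Times[OF assms(7,8) _ R_def]
  have "cent (linf_Times V1 V2) F \<in> CB" if F: "F \<in> CB" for F
  proof -
    \<comment> \<open>Coordinate centers have radius at most \<open>R F\<close>, so their pair
      witnesses that the center set is non-empty.\<close>
    obtain c1 where "c1 \<in> V1" "radius_at c1 (?p F) = rad V1 (?p F)"
      using restricted_center_propertyE[OF assms(7) CB1[OF F]] by blast
    moreover obtain c2 where "c2 \<in> V2" "radius_at c2 (?q F) = rad V2 (?q F)"
      using restricted_center_propertyE[OF assms(8) CB2[OF F]] by blast
    ultimately have "Linf c1 c2 \<in> cent (linf_Times V1 V2) F"
      unfolding cent_eq[OF F] by (simp add: linf_Times_eq_vimage R_def)
    moreover have "closed (cent (linf_Times V1 V2) F)" "bounded (cent (linf_Times V1 V2) F)"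
      unfolding cent_eq[OF F]
      by (intro closed_linf_Times bounded_linf_Times closed_sublevel_radius_at
        bounded_sublevel_radius_at CB1 CB2 F assms(2,5))+
    ultimately show ?thesis by (auto simp: CB_def)
  qed
  moreover have "\<exists>\<delta>>0. \<forall>A\<in>CB. hausdorff_dist A B < \<delta> \<longrightarrow>
      (\<forall>z\<in>cent (linf_Times V1 V2) B. ball z \<epsilon> \<inter> cent (linf_Times V1 V2) A \<noteq> {})"
    if B: "B \<in> CB" and "\<epsilon> > 0" for B and \<epsilon> :: real
  proof -
    have "rad V1 (?p B) \<le> R B" by (simp add: R_def)
    from sublevel_radius_at_perturb[OF assms(3,7,9) CB1[OF B] this \<open>\<epsilon> > 0\<close>]
    obtain \<delta>1 where \<delta>1: "\<delta>1 > 0"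
      "\<And>A R' z. A \<in> CB \<Longrightarrow> hausdorff_dist A (?p B) < \<delta>1 \<Longrightarrow> rad V1 A \<le> R' \<Longrightarrow> R B < R' + \<delta>1 \<Longrightarrow>
         z \<in> V1 \<Longrightarrow> radius_at z (?p B) \<le> R B \<Longrightarrow> \<exists>w\<in>V1. radius_at w A \<le> R' \<and> dist z w < \<epsilon>"
      by blast
    have "rad V2 (?q B) \<le> R B" by (simp add: R_def)
    from sublevel_radius_at_perturb[OF assms(6,8,10) CB2[OF B] this \<open>\<epsilon> > 0\<close>]
    obtain \<delta>2 where \<delta>2: "\<delta>2 > 0"
      "\<And>A R' z. A \<in> CB \<Longrightarrow> hausdorff_dist A (?q B) < \<delta>2 \<Longrightarrow> rad V2 A \<le> R' \<Longrightarrow> R B < R' + \<delta>2 \<Longrightarrow>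
         z \<in> V2 \<Longrightarrow> radius_at z (?q B) \<le> R B \<Longrightarrow> \<exists>w\<in>V2. radius_at w A \<le> R' \<and> dist z w < \<epsilon>"
      by blast
    show ?thesis
    proof (intro exI conjI ballI impI)
      show "min \<delta>1 \<delta>2 > 0" using \<delta>1(1) \<delta>2(1) by simp
      fix A z
      assume A: "A \<in> CB" and d: "hausdorff_dist A B < min \<delta>1 \<delta>2"
        and z: "z \<in> cent (linf_Times V1 V2) B"
      have d1: "hausdorff_dist (?p A) (?p B) < min \<delta>1 \<delta>2"
        by (rule hausdorff_dist_closure_image[OF bounded_linear_lfst _ A B d])
          (simp add: norm_diff_linf_sum)
      have d2: "hausdorff_dist (?q A) (?q B) < min \<delta>1 \<delta>2"
        by (rule hausdorff_dist_closure_image[OF bounded_linear_lsnd _ A B d])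
          (simp add: norm_diff_linf_sum)
      \<comment> \<open>Both restricted radii obey this one-sided bound, hence so does their
        maximum; \<open>R A\<close> then serves as the level \<open>R'\<close> in both
        coordinates.\<close>
      have R: "R B < R A + min \<delta>1 \<delta>2"
        using rad_less_rad_add[OF assms(7) CB1[OF A] CB1[OF B] d1]
          rad_less_rad_add[OF assms(8) CB2[OF A] CB2[OF B] d2]
        unfolding R_def by linarith
      have "lfst z \<in> V1" "radius_at (lfst z) (?p B) \<le> R B"
        "lsnd z \<in> V2" "radius_at (lsnd z) (?q B) \<le> R B"
        using z unfolding cent_eq[OF B] by (auto simp: linf_Times_eq_vimage)
      moreover have "hausdorff_dist (?p A) (?p B) < \<delta>1" "hausdorff_dist (?q A) (?q B) < \<delta>2"
        "R B < R A + \<delta>1" "R B < R A + \<delta>2" "rad V1 (?p A) \<le> R A" "rad V2 (?q A) \<le> R A"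
        using d1 d2 R by (linarith, linarith, linarith, linarith, simp_all add: R_def)
      ultimately obtain w1 w2 where "w1 \<in> V1" "radius_at w1 (?p A) \<le> R A" "dist (lfst z) w1 < \<epsilon>"
        "w2 \<in> V2" "radius_at w2 (?q A) \<le> R A" "dist (lsnd z) w2 < \<epsilon>"
        using \<delta>1(2)[OF CB1[OF A]] \<delta>2(2)[OF CB2[OF A]] by meson
      \<comment> \<open>The coordinates can be chosen independently: the maximum norm keeps the pair
        within the same \<epsilon>.\<close>
      then have "Linf w1 w2 \<in> ball z \<epsilon> \<inter> cent (linf_Times V1 V2) A"
        unfolding cent_eq[OF A]
        by (simp add: linf_Times_eq_vimage dist_norm norm_diff_linf_sum)
      then show "ball z \<epsilon> \<inter> cent (linf_Times V1 V2) A \<noteq> {}" by blast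
    qed
  qed
  ultimately show ?thesis
    unfolding lower_Hausdorff_semicontinuous_def by blast
qed

end
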